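(* Let $(\mathcal{K},\square:\mathcal{K}\to\mathcal{L},\{\mathbb{J}_\nu;\nu\in\Lambda\})$ be an asymptotic category such that the rigged category $(\mathcal{K},\square)$ is freedom-loving. Then an object $P$ in $\mathcal{K}$ is asymptotically projective if and only if it is an asymptotic retract of a free object.
   Context: A rig of a category $\mathcal{K}$ is a faithful covariant functor $\square:\mathcal{K}\to\mathcal{L}$; the pair is a rigged category. An object $F$ of $\mathcal{K}$ is free with base $M\in\mathcal{L}$ if for every $X\in\mathcal{K}$ there is a bijection $\mathrm{Hom}_{\mathcal{L}}(M,\square X)\to\mathrm{Hom}_{\mathcal{K}}(F,X)$, natural in $X$. The rigged category is freedom-loving if every object of $\mathcal{L}$ is a base of a free object. An asymptotic structure on $\mathcal{K}$ is a family $\{\mathbb{J}_\nu;\nu\in\Lambda\}$ of natural transformations of the identity functor of $\mathcal{K}$ into itself (so $\mathbb{J}_\nu^X:X\to X$ and $\varphi\mathbb{J}_\nu^X=\mathbb{J}_\nu^Y\varphi$ for every $\varphi:X\to Y$) such that (i) every $\mathbb{J}_\nu^X$ is a bimorphism (mono and epi); (ii) for every $\nu\in\Lambda$ there are $\lambda,\mu\in\Lambda$ with $\mathbb{J}_\nu=\mathbb{J}_\lambda\mathbb{J}_\mu$. An asymptotic category is a triple consisting of a category, a rig of it and an asymptotic structure on it. A morphism $\varphi:X\to Y$ is permitted if $\varphi=\widetilde\varphi\,\mathbb{J}_\nu^X$ for some $\nu\in\Lambda$ and some $\widetilde\varphi:X\to Y$. A morphism $\tau:Y\to X$ in $\mathcal{K}$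 is an asymptotically admissible epimorphism if for every $\nu\in\Lambda$ there is a morphism $\rho_\nu:\square(X)\to\square(Y)$ in $\mathcal{L}$ with $\square(\tau)\rho_\nu\square(\mathbb{J}_\nu^X)=\square(\mathbb{J}_\nu^X)$. An object $P$ is asymptotically projective if for every asymptotically admissible epimorphism $\tau:Y\to X$ every permitted morphism $\varphi:P\to X$ has a lifting across $\tau$, i.e. there is $\psi:P\to Y$ in $\mathcal{K}$ with $\tau\psi=\varphi$. A morphism $\sigma:U\to V$ is an asymptotic retraction if for every $\nu\in\Lambda$ there is a morphism $\zeta_\nu:V\to U$ with $\sigma\zeta_\nu=\mathbb{J}_\nu^V$; in that case $V$ is called an asymptotic retract of $U$. *)

theory Defs
  imports Main
begin

text \<open>
  A category consists of a set of objects and a set of arrows inside arbitrary types, so no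
  smallness is imposed relative to a fixed universe. Every arrow carries its domain and codomain,
  and \<open>g \<cdot>\<^bsub>C\<^esub> f\<close> means \<open>g\<close> after \<open>f\<close>. All record fields are unconstrained outside the carriers.
\<close>

record ('o, 'a) category_data =
  Obj :: "'o set"
  Arr :: "'a set"
  Dom :: "'a \<Rightarrow> 'o"
  Cod :: "'a \<Rightarrow> 'o"
  Ident :: "'o \<Rightarrow> 'a"
  Comp :: "'a \<Rightarrow> 'a \<Rightarrow> 'a"  (infixl "\<cdot>\<index>" 70)

definition Hom :: "('o, 'a, 'z) category_data_scheme \<Rightarrow> 'o \<Rightarrow> 'o \<Rightarrow> 'a set" where
  "Hom C X Y = {f \<in> Arr C. Dom C f = X \<and> Cod C f = Y}"

locale category =
  fixes C :: "('o, 'a, 'z) category_data_scheme" (structure)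
  assumes dom_in_Obj: "f \<in> Arr C \<Longrightarrow> Dom C f \<in> Obj C"
    and cod_in_Obj: "f \<in> Arr C \<Longrightarrow> Cod C f \<in> Obj C"
    and ident_in_Hom: "X \<in> Obj C \<Longrightarrow> Ident C X \<in> Hom C X X"
    and comp_in_Hom: "\<lbrakk>f \<in> Hom C X Y; g \<in> Hom C Y Z\<rbrakk> \<Longrightarrow> g \<cdot> f \<in> Hom C X Z"
    and comp_assoc: "\<lbrakk>f \<in> Hom C W X; g \<in> Hom C X Y; h \<in> Hom C Y Z\<rbrakk>
                      \<Longrightarrow> (h \<cdot> g) \<cdot> f = h \<cdot> (g \<cdot> f)"
    and ident_left: "f \<in> Hom C X Y \<Longrightarrow> Ident C Y \<cdot> f = f"
    and ident_right: "f \<in> Hom C X Y \<Longrightarrow> f \<cdot> Ident C X = f"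

definition monomorphism :: "('o, 'a, 'z) category_data_scheme \<Rightarrow> 'a \<Rightarrow> bool" where
  "monomorphism C f \<longleftrightarrow> f \<in> Arr C \<and>
     (\<forall>W \<in> Obj C. \<forall>g \<in> Hom C W (Dom C f). \<forall>h \<in> Hom C W (Dom C f).
        f \<cdot>\<^bsub>C\<^esub> g = f \<cdot>\<^bsub>C\<^esub> h \<longrightarrow> g = h)"

definition epimorphism :: "('o, 'a, 'z) category_data_scheme \<Rightarrow> 'a \<Rightarrow> bool" where
  "epimorphism C f \<longleftrightarrow> f \<in> Arr C \<and>
     (\<forall>Z \<in> Obj C. \<forall>g \<in> Hom C (Cod C f) Z. \<forall>h \<in> Hom C (Cod C f) Z.
        g \<cdot>\<^bsub>C\<^esub> f = h \<cdot>\<^bsub>C\<^esub> f \<longrightarrow> g = h)"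

definition bimorphism :: "('o, 'a, 'z) category_data_scheme \<Rightarrow> 'a \<Rightarrow> bool" where
  "bimorphism C f \<longleftrightarrow> monomorphism C f \<and> epimorphism C f"

record ('o1, 'a1, 'o2, 'a2) functor_data =
  on_Obj :: "'o1 \<Rightarrow> 'o2"
  on_Arr :: "'a1 \<Rightarrow> 'a2"

locale covariant_functor =
  K: category K + L: category L
  for K :: "('o1, 'a1, 'z1) category_data_scheme"
    and L :: "('o2, 'a2, 'z2) category_data_scheme" +
  fixes F :: "('o1, 'a1, 'o2, 'a2) functor_data"
  assumes on_Obj_closed: "X \<in> Obj K \<Longrightarrow> on_Obj F X \<in> Obj L"
    and on_Arr_Hom: "f \<in> Hom K X Y \<Longrightarrow> on_Arr F f \<in> Hom L (on_Obj F X) (on_Obj F Y)"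
    and on_Arr_ident: "X \<in> Obj K \<Longrightarrow> on_Arr F (Ident K X) = Ident L (on_Obj F X)"
    and on_Arr_comp: "\<lbrakk>f \<in> Hom K X Y; g \<in> Hom K Y Z\<rbrakk>
                       \<Longrightarrow> on_Arr F (g \<cdot>\<^bsub>K\<^esub> f) = on_Arr F g \<cdot>\<^bsub>L\<^esub> on_Arr F f"

definition identity_functor :: "('o, 'a, 'o, 'a) functor_data" where
  "identity_functor = \<lparr>on_Obj = (\<lambda>X. X), on_Arr = (\<lambda>f. f)\<rparr>"

locale natural_transformation =
  F: covariant_functor K L F + G: covariant_functor K L G
  for K :: "('o1, 'a1, 'z1) category_data_scheme"
    and L :: "('o2, 'a2, 'z2) category_data_scheme"
    and F G :: "('o1, 'a1, 'o2, 'a2) functor_data" +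
  fixes \<eta> :: "'o1 \<Rightarrow> 'a2"
  assumes component_in_Hom: "X \<in> Obj K \<Longrightarrow> \<eta> X \<in> Hom L (on_Obj F X) (on_Obj G X)"
    and naturality: "f \<in> Hom K X Y \<Longrightarrow> on_Arr G f \<cdot>\<^bsub>L\<^esub> \<eta> X = \<eta> Y \<cdot>\<^bsub>L\<^esub> on_Arr F f"

locale rigged_category = covariant_functor K L R
  for K :: "('o1, 'a1, 'z1) category_data_scheme"
    and L :: "('o2, 'a2, 'z2) category_data_scheme"
    and R :: "('o1, 'a1, 'o2, 'a2) functor_data" +
  assumes faithful: "\<lbrakk>X \<in> Obj K; Y \<in> Obj K\<rbrakk> \<Longrightarrow> inj_on (on_Arr R) (Hom K X Y)"

definition free_with_base ::
  "('o1, 'a1, 'z1) category_data_scheme \<Rightarrow> ('o2, 'a2, 'z2) category_data_scheme \<Rightarrow>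
   ('o1, 'a1, 'o2, 'a2) functor_data \<Rightarrow> 'o1 \<Rightarrow> 'o2 \<Rightarrow> bool" where
  "free_with_base K L R F M \<longleftrightarrow> F \<in> Obj K \<and> M \<in> Obj L \<and>
     (\<exists>\<beta> :: 'o1 \<Rightarrow> 'a2 \<Rightarrow> 'a1.
        (\<forall>X \<in> Obj K. bij_betw (\<beta> X) (Hom L M (on_Obj R X)) (Hom K F X)) \<and>
        (\<forall>X \<in> Obj K. \<forall>Y \<in> Obj K. \<forall>\<phi> \<in> Hom K X Y. \<forall>f \<in> Hom L M (on_Obj R X).
           \<beta> Y (on_Arr R \<phi> \<cdot>\<^bsub>L\<^esub> f) = \<phi> \<cdot>\<^bsub>K\<^esub> \<beta> X f))"

definition free_object ::
  "('o1, 'a1, 'z1) category_data_scheme \<Rightarrow> ('o2, 'a2, 'z2) category_data_scheme \<Rightarrow>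
   ('o1, 'a1, 'o2, 'a2) functor_data \<Rightarrow> 'o1 \<Rightarrow> bool" where
  "free_object K L R F \<longleftrightarrow> (\<exists>M \<in> Obj L. free_with_base K L R F M)"

definition freedom_loving ::
  "('o1, 'a1, 'z1) category_data_scheme \<Rightarrow> ('o2, 'a2, 'z2) category_data_scheme \<Rightarrow>
   ('o1, 'a1, 'o2, 'a2) functor_data \<Rightarrow> bool" where
  "freedom_loving K L R \<longleftrightarrow> (\<forall>M \<in> Obj L. \<exists>F \<in> Obj K. free_with_base K L R F M)"

text \<open>
  The index set \<open>\<Lambda>\<close> may be empty. \<open>J \<nu> X\<close> is the component at \<open>X\<close> of the \<open>\<nu>\<close>-th transformation;
  equality of natural transformations means equality of all components at objects of \<open>K\<close>.
\<close>

locale asymptotic_structure = category K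
  for K :: "('o, 'a, 'z) category_data_scheme" +
  fixes \<Lambda> :: "'i set"
    and J :: "'i \<Rightarrow> 'o \<Rightarrow> 'a"
  assumes natural:
      "\<nu> \<in> \<Lambda> \<Longrightarrow> natural_transformation K K identity_functor identity_functor (J \<nu>)"
    and bimorphic: "\<lbrakk>\<nu> \<in> \<Lambda>; X \<in> Obj K\<rbrakk> \<Longrightarrow> bimorphism K (J \<nu> X)"
    and factorization:
      "\<nu> \<in> \<Lambda> \<Longrightarrow> \<exists>\<kappa> \<in> \<Lambda>. \<exists>\<mu> \<in> \<Lambda>. \<forall>X \<in> Obj K. J \<nu> X = J \<kappa> X \<cdot>\<^bsub>K\<^esub> J \<mu> X"

locale asymptotic_category =
  rigged_category K L R + asymptotic_structure K \<Lambda> J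
  for K :: "('o1, 'a1, 'z1) category_data_scheme"
    and L :: "('o2, 'a2, 'z2) category_data_scheme"
    and R :: "('o1, 'a1, 'o2, 'a2) functor_data"
    and \<Lambda> :: "'i set"
    and J :: "'i \<Rightarrow> 'o1 \<Rightarrow> 'a1"

definition permitted ::
  "('o, 'a, 'z) category_data_scheme \<Rightarrow> 'i set \<Rightarrow> ('i \<Rightarrow> 'o \<Rightarrow> 'a) \<Rightarrow> 'a \<Rightarrow> bool" where
  "permitted K \<Lambda> J \<phi> \<longleftrightarrow> \<phi> \<in> Arr K \<and>
     (\<exists>\<nu> \<in> \<Lambda>. \<exists>\<phi>' \<in> Hom K (Dom K \<phi>) (Cod K \<phi>). \<phi> = \<phi>' \<cdot>\<^bsub>K\<^esub> J \<nu> (Dom K \<phi>))"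

text \<open>
  The word ``epimorphism'' is part of the name and not a separate requirement; for nonempty \<open>\<Lambda>\<close>
  these morphisms are epimorphisms because \<open>R\<close> is faithful and the \<open>J \<nu> X\<close> are epimorphisms.
\<close>

definition asymptotically_admissible_epimorphism ::
  "('o1, 'a1, 'z1) category_data_scheme \<Rightarrow> ('o2, 'a2, 'z2) category_data_scheme \<Rightarrow>
   ('o1, 'a1, 'o2, 'a2) functor_data \<Rightarrow> 'i set \<Rightarrow> ('i \<Rightarrow> 'o1 \<Rightarrow> 'a1) \<Rightarrow> 'a1 \<Rightarrow> bool" where
  "asymptotically_admissible_epimorphism K L R \<Lambda> J \<tau> \<longleftrightarrow> \<tau> \<in> Arr K \<and>
     (\<forall>\<nu> \<in> \<Lambda>. \<exists>\<rho> \<in> Hom L (on_Obj R (Cod K \<tau>)) (on_Obj R (Dom K \<tau>)).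
        (on_Arr R \<tau> \<cdot>\<^bsub>L\<^esub> \<rho>) \<cdot>\<^bsub>L\<^esub> on_Arr R (J \<nu> (Cod K \<tau>)) = on_Arr R (J \<nu> (Cod K \<tau>)))"

definition asymptotically_projective ::
  "('o1, 'a1, 'z1) category_data_scheme \<Rightarrow> ('o2, 'a2, 'z2) category_data_scheme \<Rightarrow>
   ('o1, 'a1, 'o2, 'a2) functor_data \<Rightarrow> 'i set \<Rightarrow> ('i \<Rightarrow> 'o1 \<Rightarrow> 'a1) \<Rightarrow> 'o1 \<Rightarrow> bool" where
  "asymptotically_projective K L R \<Lambda> J P \<longleftrightarrow> P \<in> Obj K \<and>
     (\<forall>X \<in> Obj K. \<forall>Y \<in> Obj K. \<forall>\<tau> \<in> Hom K Y X. \<forall>\<phi> \<in> Hom K P X.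
        asymptotically_admissible_epimorphism K L R \<Lambda> J \<tau> \<longrightarrow> permitted K \<Lambda> J \<phi> \<longrightarrow>
        (\<exists>\<psi> \<in> Hom K P Y. \<tau> \<cdot>\<^bsub>K\<^esub> \<psi> = \<phi>))"

definition asymptotic_retraction ::
  "('o, 'a, 'z) category_data_scheme \<Rightarrow> 'i set \<Rightarrow> ('i \<Rightarrow> 'o \<Rightarrow> 'a) \<Rightarrow> 'a \<Rightarrow> bool" where
  "asymptotic_retraction K \<Lambda> J \<sigma> \<longleftrightarrow> \<sigma> \<in> Arr K \<and>
     (\<forall>\<nu> \<in> \<Lambda>. \<exists>\<zeta> \<in> Hom K (Cod K \<sigma>) (Dom K \<sigma>). \<sigma> \<cdot>\<^bsub>K\<^esub> \<zeta> = J \<nu> (Cod K \<sigma>))"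

text \<open>\<open>V\<close> is an asymptotic retract of \<open>U\<close>; the retract is the first object argument.\<close>

definition asymptotic_retract_of ::
  "('o, 'a, 'z) category_data_scheme \<Rightarrow> 'i set \<Rightarrow> ('i \<Rightarrow> 'o \<Rightarrow> 'a) \<Rightarrow> 'o \<Rightarrow> 'o \<Rightarrow> bool" where
  "asymptotic_retract_of K \<Lambda> J V U \<longleftrightarrow> (\<exists>\<sigma> \<in> Hom K U V. asymptotic_retraction K \<Lambda> J \<sigma>)"

end

theory Submission
  imports Defs
begin

text \<open>
  The counit \<open>\<epsilon>\<close> of a free object over \<open>\<box>P\<close> satisfies \<open>\<box>\<epsilon> \<eta> = 1\<close>, so it is admissible, and
  lifting the permitted morphisms \<open>J\<^sub>\<nu>\<close> across it makes it an asymptotic retraction.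
  Conversely, let \<open>\<sigma> : F \<rightarrow> P\<close> be an asymptotic retraction with \<open>F\<close> free, and split the factor of a
  permitted morphism as \<open>\<phi> = \<phi>' J\<^sub>\<kappa> J\<^sub>\<mu>\<close>. One factor yields \<open>J\<^sub>\<mu> = \<sigma> \<zeta>\<close>; naturality moves the other
  one to the target, where admissibility of \<open>\<tau>\<close> and freeness of \<open>F\<close> lift \<open>\<phi>' J\<^sub>\<kappa> \<sigma> = J\<^sub>\<kappa> \<phi>' \<sigma>\<close>
  across \<open>\<tau>\<close>.
\<close>

lemma (in category) Hom_objects:
  assumes "f \<in> Hom C X Y"
  shows "X \<in> Obj C" "Y \<in> Obj C"
  using assms dom_in_Obj cod_in_Obj by (auto simp: Hom_def)

text \<open>This is a triangle identity obtained at a single object: \<epsilon> corresponds under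
  freeness to the identity of the base, and \<eta> is the arrow corresponding to the identity of
  \<open>E\<close>.\<close>

lemma (in covariant_functor) free_counit_split:
  assumes free: "free_with_base K L F E (on_Obj F P)" and P: "P \<in> Obj K"
  obtains \<epsilon> \<eta> where "\<epsilon> \<in> Hom K E P" "\<eta> \<in> Hom L (on_Obj F P) (on_Obj F E)"
    "on_Arr F \<epsilon> \<cdot>\<^bsub>L\<^esub> \<eta> = Ident L (on_Obj F P)"
proof -
  let ?M = "on_Obj F P"
  obtain \<beta> where E: "E \<in> Obj K"
    and bij: "\<And>X. X \<in> Obj K \<Longrightarrow> bij_betw (\<beta> X) (Hom L ?M (on_Obj F X)) (Hom K E X)"
    and nat: "\<And>X Y \<phi> f. \<lbrakk>X \<in> Obj K; Y \<in> Obj K; \<phi> \<in> Hom K X Y; f \<in> Hom L ?M (on_Obj F X)\<rbrakk>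
                \<Longrightarrow> \<beta> Y (on_Arr F \<phi> \<cdot>\<^bsub>L\<^esub> f) = \<phi> \<cdot>\<^bsub>K\<^esub> \<beta> X f"
    using free unfolding free_with_base_def by metis
  have id: "Ident L ?M \<in> Hom L ?M ?M"
    using P by (simp add: L.ident_in_Hom on_Obj_closed)
  define \<epsilon> where "\<epsilon> = \<beta> P (Ident L ?M)"
  have \<epsilon>: "\<epsilon> \<in> Hom K E P"
    unfolding \<epsilon>_def using bij_betwE[OF bij[OF P]] id by blast
  have "Ident K E \<in> \<beta> E ` Hom L ?M (on_Obj F E)"
    using bij_betw_imp_surj_on[OF bij[OF E]] K.ident_in_Hom[OF E] by simp
  then obtain \<eta> where \<eta>: "\<eta> \<in> Hom L ?M (on_Obj F E)" "\<beta> E \<eta> = Ident K E"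
    by auto
  \<comment> \<open>\<open>\<beta> P\<close> takes the value \<epsilon> at both arguments: on the
    left by naturality along \<epsilon>, because \<open>\<beta> E \<eta>\<close> is the identity.
    Injectivity then cancels \<open>\<beta> P\<close>.\<close>
  have "\<beta> P (on_Arr F \<epsilon> \<cdot>\<^bsub>L\<^esub> \<eta>) = \<beta> P (Ident L ?M)"
    using nat[OF E P \<epsilon> \<eta>(1)] \<eta>(2) K.ident_right[OF \<epsilon>] by (simp add: \<epsilon>_def)
  then have "on_Arr F \<epsilon> \<cdot>\<^bsub>L\<^esub> \<eta> = Ident L ?M"
    using bij_betw_imp_inj_on[OF bij[OF P]] id L.comp_in_Hom[OF \<eta>(1) on_Arr_Hom[OF \<epsilon>]]
    by (auto dest: inj_onD)
  with \<epsilon> \<eta>(1) show thesis by (rule that)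
qed

context asymptotic_category
begin

lemma J_in_Hom:
  assumes "\<nu> \<in> \<Lambda>" "X \<in> Obj K"
  shows "J \<nu> X \<in> Hom K X X"
  using natural_transformation.component_in_Hom[OF natural[OF assms(1)] assms(2)]
  by (simp add: identity_functor_def)

lemma J_commute:
  assumes "\<nu> \<in> \<Lambda>" "f \<in> Hom K X Y"
  shows "f \<cdot>\<^bsub>K\<^esub> J \<nu> X = J \<nu> Y \<cdot>\<^bsub>K\<^esub> f"
  using natural_transformation.naturality[OF natural[OF assms(1)] assms(2)]
  by (simp add: identity_functor_def)

lemma permitted_J:
  assumes \<nu>: "\<nu> \<in> \<Lambda>" and X: "X \<in> Obj K"
  shows "permitted K \<Lambda> J (J \<nu> X)"
proof -
  note J = J_in_Hom[OF assms]
  have "J \<nu> X = Ident K X \<cdot>\<^bsub>K\<^esub> J \<nu> X"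
    using K.ident_left[OF J] by simp
  with J \<nu> K.ident_in_Hom[OF X] show ?thesis
    unfolding permitted_def Hom_def by auto
qed

text \<open>A genuine section \<rho> in \<open>L\<close> serves as the witness for every \<nu> at
  once.\<close>

lemma split_imp_asymptotically_admissible:
  assumes \<tau>: "\<tau> \<in> Hom K Y X" and \<rho>: "\<rho> \<in> Hom L (on_Obj R X) (on_Obj R Y)"
    and split: "on_Arr R \<tau> \<cdot>\<^bsub>L\<^esub> \<rho> = Ident L (on_Obj R X)"
  shows "asymptotically_admissible_epimorphism K L R \<Lambda> J \<tau>"
proof -
  have "(on_Arr R \<tau> \<cdot>\<^bsub>L\<^esub> \<rho>) \<cdot>\<^bsub>L\<^esub> on_Arr R (J \<nu> X) = on_Arr R (J \<nu> X)" if "\<nu> \<in> \<Lambda>" for \<nu>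
    unfolding split by (rule L.ident_left[OF on_Arr_Hom[OF J_in_Hom[OF that K.Hom_objects(2)[OF \<tau>]]]])
  with \<tau> \<rho> show ?thesis
    unfolding asymptotically_admissible_epimorphism_def Hom_def by auto
qed

text \<open>The arrow \<rho> supplied by admissibility lives in \<open>L\<close>, so the lift is
  built there and carried back to \<open>K\<close> by freeness. Since \<rho> is known to act as a
  section only after \<open>on_Arr R (J \<kappa> X)\<close>, it is \<open>J \<kappa> X\<close>
  composed with \<open>g\<close> that gets lifted, not \<open>g\<close> itself.\<close>

lemma free_lifting:
  assumes free: "free_with_base K L R E M"
    and \<tau>: "\<tau> \<in> Hom K Y X" "asymptotically_admissible_epimorphism K L R \<Lambda> J \<tau>"
    and \<kappa>: "\<kappa> \<in> \<Lambda>" and g: "g \<in> Hom K E X"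
  obtains \<psi> where "\<psi> \<in> Hom K E Y" "\<tau> \<cdot>\<^bsub>K\<^esub> \<psi> = J \<kappa> X \<cdot>\<^bsub>K\<^esub> g"
proof -
  note Y = K.Hom_objects(1)[OF \<tau>(1)] and X = K.Hom_objects(2)[OF \<tau>(1)]
  obtain \<beta> where bij: "\<And>X. X \<in> Obj K \<Longrightarrow> bij_betw (\<beta> X) (Hom L M (on_Obj R X)) (Hom K E X)"
    and nat: "\<And>X Y \<phi> f. \<lbrakk>X \<in> Obj K; Y \<in> Obj K; \<phi> \<in> Hom K X Y; f \<in> Hom L M (on_Obj R X)\<rbrakk>
                \<Longrightarrow> \<beta> Y (on_Arr R \<phi> \<cdot>\<^bsub>L\<^esub> f) = \<phi> \<cdot>\<^bsub>K\<^esub> \<beta> X f"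
    using free unfolding free_with_base_def by metis
  obtain \<rho> where \<rho>: "\<rho> \<in> Hom L (on_Obj R X) (on_Obj R Y)"
    and \<rho>_eq: "(on_Arr R \<tau> \<cdot>\<^bsub>L\<^esub> \<rho>) \<cdot>\<^bsub>L\<^esub> on_Arr R (J \<kappa> X) = on_Arr R (J \<kappa> X)"
    using \<tau> \<kappa> unfolding asymptotically_admissible_epimorphism_def Hom_def by auto
  obtain f where f: "f \<in> Hom L M (on_Obj R X)" "\<beta> X f = g"
    using bij_betw_imp_surj_on[OF bij[OF X]] g by (metis imageE)
  note JX = J_in_Hom[OF \<kappa> X]
  note RJ = on_Arr_Hom[OF JX] and R\<tau> = on_Arr_Hom[OF \<tau>(1)]
  \<comment> \<open>The transpose \<open>f\<close> of \<open>g\<close> is first pushed through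
    \<open>J \<kappa> X\<close>, so that \<rho> is applied where \<tau> undoes it.\<close>
  let ?u = "\<rho> \<cdot>\<^bsub>L\<^esub> (on_Arr R (J \<kappa> X) \<cdot>\<^bsub>L\<^esub> f)"
  note Jf = L.comp_in_Hom[OF f(1) RJ]
  have u: "?u \<in> Hom L M (on_Obj R Y)"
    by (rule L.comp_in_Hom[OF Jf \<rho>])
  have "on_Arr R \<tau> \<cdot>\<^bsub>L\<^esub> ?u = (on_Arr R \<tau> \<cdot>\<^bsub>L\<^esub> \<rho>) \<cdot>\<^bsub>L\<^esub> (on_Arr R (J \<kappa> X) \<cdot>\<^bsub>L\<^esub> f)"
    using L.comp_assoc[OF Jf \<rho> R\<tau>] by simp
  also have "\<dots> = on_Arr R (J \<kappa> X) \<cdot>\<^bsub>L\<^esub> f"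
    using L.comp_assoc[OF f(1) RJ L.comp_in_Hom[OF \<rho> R\<tau>]] \<rho>_eq by simp
  \<comment> \<open>Naturality of \<beta> is used along \<tau> on the left and along
    \<open>J \<kappa> X\<close> on the right.\<close>
  finally have "\<tau> \<cdot>\<^bsub>K\<^esub> \<beta> Y ?u = J \<kappa> X \<cdot>\<^bsub>K\<^esub> g"
    using nat[OF Y X \<tau>(1) u] nat[OF X X JX f(1)] f(2) by simp
  moreover have "\<beta> Y ?u \<in> Hom K E Y"
    using bij_betwE[OF bij[OF Y]] u by blast
  ultimately show thesis using that by blast
qed

lemma asymptotically_projective_imp_retract_of_free:
  assumes proj: "asymptotically_projective K L R \<Lambda> J P"
    and free: "free_with_base K L R E (on_Obj R P)"
  shows "asymptotic_retract_of K \<Lambda> J P E"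
proof -
  have P: "P \<in> Obj K" and E: "E \<in> Obj K"
    using proj free by (auto simp: asymptotically_projective_def free_with_base_def)
  obtain \<epsilon> \<eta> where \<epsilon>: "\<epsilon> \<in> Hom K E P" and \<eta>: "\<eta> \<in> Hom L (on_Obj R P) (on_Obj R E)"
    "on_Arr R \<epsilon> \<cdot>\<^bsub>L\<^esub> \<eta> = Ident L (on_Obj R P)"
    by (rule free_counit_split[OF free P])
  \<comment> \<open>A lift of \<open>J \<nu> P\<close> across \<epsilon> is precisely the section
    required at the index \<nu>.\<close>
  have "\<exists>\<zeta> \<in> Hom K P E. \<epsilon> \<cdot>\<^bsub>K\<^esub> \<zeta> = J \<nu> P" if \<nu>: "\<nu> \<in> \<Lambda>" for \<nu>
    using proj P E \<epsilon> J_in_Hom[OF \<nu> P] permitted_J[OF \<nu> P]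
      split_imp_asymptotically_admissible[OF \<epsilon> \<eta>]
    unfolding asymptotically_projective_def by blast
  with \<epsilon> show ?thesis
    unfolding asymptotic_retract_of_def asymptotic_retraction_def Hom_def by auto
qed

text \<open>The base \<open>M\<close> is arbitrary: freeness enters only through lifting out of
  \<open>E\<close>.\<close>

lemma retract_of_free_imp_asymptotically_projective:
  assumes free: "free_with_base K L R E M"
    and retract: "asymptotic_retract_of K \<Lambda> J P E"
  shows "asymptotically_projective K L R \<Lambda> J P"
proof -
  obtain \<sigma> where \<sigma>: "\<sigma> \<in> Hom K E P"
    and section_ex: "\<And>\<nu>. \<nu> \<in> \<Lambda> \<Longrightarrow> \<exists>\<zeta> \<in> Hom K P E. \<sigma> \<cdot>\<^bsub>K\<^esub> \<zeta> = J \<nu> P"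
    using retract unfolding asymptotic_retract_of_def asymptotic_retraction_def Hom_def by auto
  note P = K.Hom_objects(2)[OF \<sigma>]
  have "\<exists>\<psi> \<in> Hom K P Y. \<tau> \<cdot>\<^bsub>K\<^esub> \<psi> = \<phi>"
    if \<tau>: "\<tau> \<in> Hom K Y X" "asymptotically_admissible_epimorphism K L R \<Lambda> J \<tau>"
      and \<phi>: "\<phi> \<in> Hom K P X" "permitted K \<Lambda> J \<phi>" for X Y \<tau> \<phi>
  proof -
    obtain \<nu> \<phi>' where \<nu>: "\<nu> \<in> \<Lambda>" and \<phi>': "\<phi>' \<in> Hom K P X" "\<phi> = \<phi>' \<cdot>\<^bsub>K\<^esub> J \<nu> P"
      using \<phi> unfolding permitted_def Hom_def by auto
    \<comment> \<open>Two factors are needed because both ingredients cost one: \<mu> pays for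
      passing from \<open>P\<close> to \<open>E\<close> by a section of \<sigma>, and \<kappa> for
      lifting across \<tau>.\<close>
    obtain \<kappa> \<mu> where \<kappa>: "\<kappa> \<in> \<Lambda>" and \<mu>: "\<mu> \<in> \<Lambda>" and J_split: "J \<nu> P = J \<kappa> P \<cdot>\<^bsub>K\<^esub> J \<mu> P"
      using factorization[OF \<nu>] P by blast
    obtain \<zeta> where \<zeta>: "\<zeta> \<in> Hom K P E" "\<sigma> \<cdot>\<^bsub>K\<^esub> \<zeta> = J \<mu> P"
      using section_ex[OF \<mu>] by blast
    have \<phi>'\<sigma>: "\<phi>' \<cdot>\<^bsub>K\<^esub> \<sigma> \<in> Hom K E X"
      by (rule K.comp_in_Hom[OF \<sigma> \<phi>'(1)])
    obtain \<psi> where \<psi>: "\<psi> \<in> Hom K E Y" "\<tau> \<cdot>\<^bsub>K\<^esub> \<psi> = J \<kappa> X \<cdot>\<^bsub>K\<^esub> (\<phi>' \<cdot>\<^bsub>K\<^esub> \<sigma>)"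
      by (rule free_lifting[OF free \<tau> \<kappa> \<phi>'\<sigma>])
    note JX = J_in_Hom[OF \<kappa> K.Hom_objects(2)[OF \<phi>(1)]]
    have "\<tau> \<cdot>\<^bsub>K\<^esub> (\<psi> \<cdot>\<^bsub>K\<^esub> \<zeta>) = (J \<kappa> X \<cdot>\<^bsub>K\<^esub> (\<phi>' \<cdot>\<^bsub>K\<^esub> \<sigma>)) \<cdot>\<^bsub>K\<^esub> \<zeta>"
      using K.comp_assoc[OF \<zeta>(1) \<psi>(1) \<tau>(1)] \<psi>(2) by simp
    also have "\<dots> = J \<kappa> X \<cdot>\<^bsub>K\<^esub> (\<phi>' \<cdot>\<^bsub>K\<^esub> J \<mu> P)"
      using K.comp_assoc[OF \<zeta>(1) \<phi>'\<sigma> JX] K.comp_assoc[OF \<zeta>(1) \<sigma> \<phi>'(1)] \<zeta>(2) by simp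
    \<comment> \<open>Naturality brings \<open>J \<kappa>\<close> back from \<open>X\<close> to
      \<open>P\<close>, where it recombines with \<open>J \<mu> P\<close> to
      \<open>J \<nu> P\<close>.\<close>
    also have "\<dots> = (\<phi>' \<cdot>\<^bsub>K\<^esub> J \<kappa> P) \<cdot>\<^bsub>K\<^esub> J \<mu> P"
      using K.comp_assoc[OF J_in_Hom[OF \<mu> P] \<phi>'(1) JX] J_commute[OF \<kappa> \<phi>'(1)] by simp
    also have "\<dots> = \<phi>"
      using K.comp_assoc[OF J_in_Hom[OF \<mu> P] J_in_Hom[OF \<kappa> P] \<phi>'(1)] \<phi>'(2) J_split by simp
    finally show ?thesis
      using K.comp_in_Hom[OF \<zeta>(1) \<psi>(1)] by blast
  qed
  with P show ?thesis
    unfolding asymptotically_projective_def by blast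
qed

end

theorem proposition6p12:
  fixes K :: "('o1, 'a1) category_data"
    and L :: "('o2, 'a2) category_data"
    and R :: "('o1, 'a1, 'o2, 'a2) functor_data"
    and \<Lambda> :: "'i set"
    and J :: "'i \<Rightarrow> 'o1 \<Rightarrow> 'a1"
    and P :: 'o1
  assumes "asymptotic_category K L R \<Lambda> J"
    and "freedom_loving K L R"
    and "P \<in> Obj K"
  shows "asymptotically_projective K L R \<Lambda> J P \<longleftrightarrow>
         (\<exists>F \<in> Obj K. free_object K L R F \<and> asymptotic_retract_of K \<Lambda> J P F)"
proof
  interpret asymptotic_category K L R \<Lambda> J by fact
  have base: "on_Obj R P \<in> Obj L"
    using assms(3) by (rule on_Obj_closed)
  \<comment> \<open>Freedom is invoked at the base \<open>on_Obj R P\<close>, so that the free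
    object has a counit onto \<open>P\<close>.\<close>
  then obtain E where E: "E \<in> Obj K" "free_with_base K L R E (on_Obj R P)"
    using assms(2) unfolding freedom_loving_def by blast
  assume "asymptotically_projective K L R \<Lambda> J P"
  then have "asymptotic_retract_of K \<Lambda> J P E"
    using E(2) by (rule asymptotically_projective_imp_retract_of_free)
  with E base show "\<exists>F \<in> Obj K. free_object K L R F \<and> asymptotic_retract_of K \<Lambda> J P F"
    unfolding free_object_def by blast
next
  interpret asymptotic_category K L R \<Lambda> J by fact
  assume "\<exists>F \<in> Obj K. free_object K L R F \<and> asymptotic_retract_of K \<Lambda> J P F"
  then show "asymptotically_projective K L R \<Lambda> J P"
    unfolding free_object_def using retract_of_free_imp_asymptotically_projective by blast
qed

end
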